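(* Let $n\ge1$ and $1\le i\le n$. The number of parking functions of $1,\ldots,n$ for which the $i$-th car is lucky is \[ \sum_{j=1}^nq_n(i,j)=(n+2-i)(n+1)^{n-2}=\Big(1-\frac{i-1}{n+1}\Big)(n+1)^{n-1}. \]
   Context: There are $n$ spots labeled $1,\ldots,n$ in order along a one-way street, and $n$ cars entering one after another, car $i$ having preference $a_i\in\{1,\ldots,n\}$. Each car drives to its preferred spot and parks there if it is available; otherwise it moves forward and parks in the first available later spot, if any (if none, it fails to park). A parking function of $1,\ldots,n$ is a sequence of preferences $(a_1,\ldots,a_n)$ such that all $n$ cars are able to park. A car is lucky if it parks in its preferred spot. For $1\le i,j\le n$, $q_n(i,j)$ denotes the number of parking functions of $1,\ldots,n$ in which the $i$-th car prefers the $j$-th spot and the $i$-th car is lucky. Negative exponents are interpreted in the rational numbers. *)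

theory Defs
  imports Complex_Main
begin

text \<open>
  Spots are the numbers \<open>1, \<dots>, n\<close>, and a preference sequence \<open>(a\<^sub>1, \<dots>, a\<^sub>m)\<close> is the list
  \<open>[a\<^sub>1, \<dots>, a\<^sub>m]\<close>, so that the preference of car \<open>i\<close> is the list entry at index \<open>i - 1\<close>.
\<close>

text \<open>The first spot outside \<open>occ\<close> among \<open>a, a + 1, \<dots>, n\<close>; the value is \<open>None\<close> if the car fails to park.\<close>

definition park_car :: "nat \<Rightarrow> nat set \<Rightarrow> nat \<Rightarrow> nat option" where
  "park_car n occ a = List.find (\<lambda>s. s \<notin> occ) [a..<Suc n]"

text \<open>The outcomes for cars entering one after another, with the spots in \<open>occ\<close> already taken.\<close>

primrec park_outcomes :: "nat \<Rightarrow> nat set \<Rightarrow> nat list \<Rightarrow> nat option list" where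
  "park_outcomes n occ [] = []"
| "park_outcomes n occ (a # as) =
     park_car n occ a # park_outcomes n (occ \<union> set_option (park_car n occ a)) as"

definition parking_function :: "nat \<Rightarrow> nat list \<Rightarrow> bool" where
  "parking_function n as \<longleftrightarrow>
     length as = n \<and> set as \<subseteq> {1..n} \<and> None \<notin> set (park_outcomes n {} as)"

definition lucky :: "nat \<Rightarrow> nat list \<Rightarrow> nat \<Rightarrow> bool" where
  "lucky n as i \<longleftrightarrow> park_outcomes n {} as ! (i - 1) = Some (as ! (i - 1))"

definition q :: "nat \<Rightarrow> nat \<Rightarrow> nat \<Rightarrow> nat" where
  "q n i j = card {as. parking_function n as \<and> as ! (i - 1) = j \<and> lucky n as i}"

end

theory Submission
  imports Defs
begin

text \<open>
  Pollak's circle argument: add a spot \<open>0\<close> behind spot \<open>n\<close> and close the street to a circle of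
  \<open>n + 1\<close> spots, allowing preferences in \<open>{0..n}\<close>. On the circle every car parks, exactly one spot
  stays empty, and a sequence is a parking function iff that spot is \<open>0\<close>. Rotating all preferences
  permutes the empty spot and preserves luckiness, so the lucky parking functions are exactly a
  fraction \<open>1 / (n + 1)\<close> of the lucky circular sequences. The latter are easy to count: car \<open>i\<close> must
  avoid the \<open>i - 1\<close> occupied spots, and the other preferences are free.
\<close>

section \<open>Parking on a circle of \<open>N\<close> spots\<close>

definition circ_park :: "nat \<Rightarrow> nat set \<Rightarrow> nat \<Rightarrow> nat" where
  "circ_park N occ a = (a + (LEAST k. (a + k) mod N \<notin> occ)) mod N"

primrec circ_occ :: "nat \<Rightarrow> nat set \<Rightarrow> nat list \<Rightarrow> nat set" where
  "circ_occ N occ [] = occ"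
| "circ_occ N occ (a # as) = circ_occ N (insert (circ_park N occ a) occ) as"

text \<open>Cars are indexed from 0 here. Asking that the preferred spot be free on arrival makes
  luckiness depend only on the first \<open>m + 1\<close> preferences, which lets the count
  factor.\<close>

definition circ_lucky :: "nat \<Rightarrow> nat \<Rightarrow> nat list \<Rightarrow> bool" where
  "circ_lucky N m as \<longleftrightarrow> as ! m \<notin> circ_occ N {} (take m as)"

lemma circ_park_less: "N > 0 \<Longrightarrow> circ_park N occ a < N"
  by (simp add: circ_park_def)

text \<open>The free spot \<open>x\<close> guarantees that the \<open>LEAST\<close> ranges over a
  satisfiable predicate; on a full circle its value would be arbitrary.\<close>

lemma circ_park_notin:
  assumes "x < N" "x \<notin> occ" "a < N"
  shows "circ_park N occ a \<notin> occ"
proof -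
  \<comment> \<open>One full turn is added so that the natural subtraction does not truncate when
    \<open>x < a\<close>.\<close>
  have "(a + (x + N - a)) mod N = x" using assms by simp
  then have "(a + (x + N - a)) mod N \<notin> occ" using assms by simp
  then show ?thesis unfolding circ_park_def by (rule LeastI)
qed

lemma circ_park_free:
  assumes "a < N" "a \<notin> occ"
  shows "circ_park N occ a = a"
proof -
  have "(LEAST k. (a + k) mod N \<notin> occ) = 0"
    by (rule Least_eq_0) (use assms in simp)
  then show ?thesis using assms by (simp add: circ_park_def)
qed

text \<open>The case \<open>a + k = N\<close> is included: there the car has wrapped around to spot
  0. Before that no reduction modulo \<open>N\<close> occurs.\<close>

lemma circ_park_first_free:
  assumes "a + k \<le> N" "(a + k) mod N \<notin> occ" "\<And>j. j < k \<Longrightarrow> a + j \<in> occ"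
  shows "circ_park N occ a = (a + k) mod N"
proof -
  have "(LEAST k. (a + k) mod N \<notin> occ) = k"
  proof (rule Least_equality)
    fix j assume j: "(a + j) mod N \<notin> occ"
    show "k \<le> j"
    proof (rule ccontr)
      assume "\<not> k \<le> j"
      then have "a + j < N" "a + j \<in> occ" using assms by auto
      with j show False by simp
    qed
  qed (use assms in simp)
  then show ?thesis by (simp add: circ_park_def)
qed

lemma circ_occ_mono: "occ \<subseteq> circ_occ N occ as"
proof (induction as arbitrary: occ)
  case (Cons a as)
  then have "insert (circ_park N occ a) occ \<subseteq> circ_occ N (insert (circ_park N occ a) occ) as" .
  then show ?case by simp
qed simp

lemma circ_occ_subset:
  "N > 0 \<Longrightarrow> occ \<subseteq> {..<N} \<Longrightarrow> circ_occ N occ as \<subseteq> {..<N}"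
  by (induction as arbitrary: occ) (auto simp: circ_park_less)

text \<open>As long as the circle is not full, each car takes a new spot; the length bound ensures a
  free spot for every car.\<close>

lemma card_circ_occ:
  assumes "occ \<subseteq> {..<N}" "set as \<subseteq> {..<N}" "card occ + length as \<le> N"
  shows "card (circ_occ N occ as) = card occ + length as"
  using assms
proof (induction as arbitrary: occ)
  case (Cons a as)
  have fin: "finite occ" using Cons.prems finite_subset by blast
  have "card occ < card {..<N}" using Cons.prems by simp
  then have "\<not> {..<N} \<subseteq> occ" using card_mono[OF fin] by (meson not_le)
  then obtain x where "x < N" "x \<notin> occ" by auto
  then have "circ_park N occ a \<notin> occ" using circ_park_notin Cons.prems by simp
  then have c: "card (insert (circ_park N occ a) occ) = Suc (card occ)" using fin by simp
  have "insert (circ_park N occ a) occ \<subseteq> {..<N}"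
    using Cons.prems by (auto intro: circ_park_less)
  then show ?case using Cons.IH[of "insert (circ_park N occ a) occ"] Cons.prems c by simp
qed simp

text \<open>A preferred spot is either already taken or taken by the car itself, and spots never
  become free again.\<close>

lemma set_subset_circ_occ:
  assumes "set as \<subseteq> {..<N}"
  shows "set as \<subseteq> circ_occ N occ as"
  using assms
proof (induction as arbitrary: occ)
  case (Cons a as)
  have "a \<in> insert (circ_park N occ a) occ"
    using circ_park_free[of a N occ] Cons.prems by auto
  then show ?case using Cons circ_occ_mono[of "insert (circ_park N occ a) occ" N as] by auto
qed simp

section \<open>Invariance under rotation\<close>

lemma inj_on_rotate: "inj_on (\<lambda>x. (x + c) mod N) {..<N::nat}"
proof (rule inj_onI)
  fix x y :: nat
  assume "x \<in> {..<N}" "y \<in> {..<N}" and e: "(x + c) mod N = (y + c) mod N"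
  \<comment> \<open>The shift \<open>c\<close> is cancelled by subtraction, hence the passage to
    integers.\<close>
  have "(int x + int c) mod int N = (int y + int c) mod int N"
    using e by (metis of_nat_add of_nat_mod)
  then have "int x mod int N = int y mod int N"
    using mod_diff_cong[of "int x + int c" "int N" "int y + int c" "int c" "int c"] by simp
  then show "x = y" using \<open>x \<in> {..<N}\<close> \<open>y \<in> {..<N}\<close> by simp
qed

text \<open>Rotation is injective on spots, so the same offsets \<open>k\<close> lead to a free spot
  before and after it, and the least one is unchanged.\<close>

lemma circ_park_rotate:
  assumes "N > 0" "occ \<subseteq> {..<N}"
  shows "circ_park N ((\<lambda>x. (x + c) mod N) ` occ) ((a + c) mod N) = (circ_park N occ a + c) mod N"
proof -
  let ?r = "\<lambda>x. (x + c) mod N"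
  have shift: "((a + c) mod N + k) mod N = ?r ((a + k) mod N)" for k
    by (simp add: mod_simps ac_simps)
  have "((a + c) mod N + k) mod N \<in> ?r ` occ \<longleftrightarrow> (a + k) mod N \<in> occ" for k
    unfolding shift using assms
    by (intro inj_on_image_mem_iff[OF inj_on_rotate]) auto
  then show ?thesis unfolding circ_park_def by (simp only: shift)
qed

lemma circ_occ_rotate:
  assumes "N > 0" "occ \<subseteq> {..<N}"
  shows "circ_occ N ((\<lambda>x. (x + c) mod N) ` occ) (map (\<lambda>x. (x + c) mod N) as)
    = (\<lambda>x. (x + c) mod N) ` circ_occ N occ as"
  using assms
proof (induction as arbitrary: occ)
  case (Cons a as)
  then show ?case
    using Cons.IH[of "insert (circ_park N occ a) occ"]
    by (simp add: circ_park_rotate circ_park_less)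
qed simp

lemma circ_lucky_rotate:
  assumes "set as \<subseteq> {..<N}" "m < length as"
  shows "circ_lucky N m (map (\<lambda>x. (x + c) mod N) as) \<longleftrightarrow> circ_lucky N m as"
proof -
  have a: "as ! m \<in> {..<N}" using assms nth_mem by blast
  then have "N > 0" by auto
  then show ?thesis
    using circ_occ_rotate[of N "{}" c "take m as"] assms a circ_occ_subset[of N "{}" "take m as"]
    by (simp add: circ_lucky_def take_map inj_on_image_mem_iff[OF inj_on_rotate])
qed

section \<open>Counting lucky sequences on the circle\<close>

lemma card_circ_lucky:
  assumes "m < n" "n \<le> N"
  shows "card {as. set as \<subseteq> {..<N} \<and> length as = n \<and> circ_lucky N m as}
    = (N - m) * N ^ (n - 1)"
proof -
  let ?X = "\<lambda>l. {xs. set xs \<subseteq> {..<N} \<and> length xs = l}"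
  \<comment> \<open>Cut at car \<open>m\<close>: the admissible spots for that car depend on the
    prefix, but their number \<open>N - m\<close> does not.\<close>
  let ?S = "SIGMA xs:?X m. ({..<N} - circ_occ N {} xs) \<times> ?X (n - m - 1)"
  let ?f = "\<lambda>(xs, a, ys). xs @ a # ys"
  have fin: "finite (?X l)" for l by (rule finite_lists_length_eq) simp
  have "{as. set as \<subseteq> {..<N} \<and> length as = n \<and> circ_lucky N m as} = ?f ` ?S" (is "?L = _")
  proof (intro equalityI subsetI)
    fix as assume as: "as \<in> ?L"
    then have m: "m < length as" using assms by simp
    have "as = ?f (take m as, as ! m, drop (Suc m) as)"
      using id_take_nth_drop[OF m] by simp
    moreover have "(take m as, as ! m, drop (Suc m) as) \<in> ?S"
      using as m subsetD[OF _ nth_mem[OF m], of "{..<N}"] set_take_subset[of m as]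
        set_drop_subset[of "Suc m" as]
      by (auto simp: circ_lucky_def)
    ultimately show "as \<in> ?f ` ?S" by (rule image_eqI)
  next
    fix as assume "as \<in> ?f ` ?S"
    then show "as \<in> ?L" using assms by (auto simp: circ_lucky_def nth_append)
  qed
  moreover have "inj_on ?f ?S" by (auto simp: inj_on_def)
  ultimately have "card ?L = card ?S" by (simp add: card_image)
  also have "\<dots> = (\<Sum>xs\<in>?X m. card (({..<N} - circ_occ N {} xs) \<times> ?X (n - m - 1)))"
    using fin by (intro card_SigmaI) auto
  also have "\<dots> = (\<Sum>xs\<in>?X m. (N - m) * N ^ (n - m - 1))"
  proof (rule sum.cong)
    fix xs assume xs: "xs \<in> ?X m"
    have "circ_occ N {} xs \<subseteq> {..<N}" using assms by (intro circ_occ_subset) auto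
    moreover have "card (circ_occ N {} xs) = m" using card_circ_occ[of "{}" N xs] xs assms by auto
    ultimately have "card ({..<N} - circ_occ N {} xs) = N - m"
      by (simp add: card_Diff_subset finite_subset)
    then show "card (({..<N} - circ_occ N {} xs) \<times> ?X (n - m - 1)) = (N - m) * N ^ (n - m - 1)"
      by (simp add: card_cartesian_product card_lists_length_eq)
  qed simp
  also have "\<dots> = (N - m) * (N ^ m * N ^ (n - m - 1))"
    by (simp add: card_lists_length_eq)
  also have "N ^ m * N ^ (n - m - 1) = N ^ (n - 1)"
    using assms by (simp flip: power_add)
  finally show ?thesis .
qed

text \<open>Double counting of the pairs of a sequence in \<open>L\<close> and a spot it leaves
  empty: each sequence has one such spot, and by rotation each of the \<open>N\<close> spots belongs
  to equally many sequences.\<close>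

lemma card_circ_lucky_empty_spot:
  assumes "m < n" "N = Suc n"
  defines "L \<equiv> {as. set as \<subseteq> {..<N} \<and> length as = n \<and> circ_lucky N m as}"
  shows "N * card {as \<in> L. 0 \<notin> circ_occ N {} as} = card L"
proof -
  let ?A = "\<lambda>e. {as \<in> L. e \<notin> circ_occ N {} as}"
  have N: "N > 0" using assms by simp
  have "finite {as. set as \<subseteq> {..<N} \<and> length as = n}" by (rule finite_lists_length_eq) simp
  then have fin: "finite L" by (rule rev_finite_subset) (auto simp: L_def)
  have rot: "card (?A e) \<le> card (?A ((e + c) mod N))" if e: "e < N" for e c
  proof (rule card_inj_on_le)
    let ?r = "\<lambda>x. (x + c) mod N"
    have "inj_on (map ?r) (lists {..<N})"
      by (rule inj_on_mapI) (rule inj_on_subset[OF inj_on_rotate], auto)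
    then show "inj_on (map ?r) (?A e)" by (rule inj_on_subset) (auto simp: L_def)
    show "map ?r ` ?A e \<subseteq> ?A (?r e)"
    proof (rule image_subsetI)
      fix as assume "as \<in> ?A e"
      then have as: "set as \<subseteq> {..<N}" "length as = n" "circ_lucky N m as" "e \<notin> circ_occ N {} as"
        by (auto simp: L_def)
      have "?r e \<notin> ?r ` circ_occ N {} as"
        using as(4) e circ_occ_subset[of N "{}" as] N
        by (subst inj_on_image_mem_iff[OF inj_on_rotate]) auto
      moreover have "circ_occ N {} (map ?r as) = ?r ` circ_occ N {} as"
        using circ_occ_rotate[of N "{}" c as] N by simp
      moreover have "circ_lucky N m (map ?r as)"
        using as assms(1) by (simp add: circ_lucky_rotate)
      moreover have "set (map ?r as) \<subseteq> {..<N}" "length (map ?r as) = n"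
        using as N by auto
      ultimately show "map ?r as \<in> ?A (?r e)" unfolding L_def by blast
    qed
  qed (use fin in simp)
  have eq: "card (?A e) = card (?A 0)" if "e < N" for e
  proof (rule antisym)
    \<comment> \<open>Rotating by \<open>N - e\<close> takes \<open>e\<close> to 0 and rotating by
      \<open>e\<close> takes 0 back to \<open>e\<close>, so the inequality \<open>rot\<close> holds
      both ways.\<close>
    have "(e + (N - e)) mod N = 0" using that by simp
    then show "card (?A e) \<le> card (?A 0)" using rot[OF that, of "N - e"] by (simp only:)
    have "(0 + e) mod N = e" using that by simp
    then show "card (?A 0) \<le> card (?A e)" using rot[OF N, of e] by (simp only:)
  qed
  have one: "card {e \<in> {..<N}. e \<notin> circ_occ N {} as} = 1" if "as \<in> L" for as
  proof -
    have sub: "circ_occ N {} as \<subseteq> {..<N}" using N by (intro circ_occ_subset) auto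
    have "card (circ_occ N {} as) = n"
      using card_circ_occ[of "{}" N as] that assms(2) by (simp add: L_def)
    then have "card ({..<N} - circ_occ N {} as) = 1"
      using sub assms(2) by (subst card_Diff_subset) (auto intro: finite_subset)
    then show ?thesis by (simp add: set_diff_eq)
  qed
  have "(\<Sum>e<N. card (?A e)) = 1 * card L"
    using fin one by (intro sum_multicount) auto
  moreover have "(\<Sum>e<N. card (?A e)) = (\<Sum>e<N. card (?A 0))"
    by (rule sum.cong[OF refl], rule eq) simp
  ultimately show ?thesis by simp
qed

section \<open>Comparing the street with the circle\<close>

lemma park_car_SomeD:
  assumes "park_car n occ a = Some s"
  shows "a \<le> s \<and> s \<le> n \<and> s \<notin> occ \<and> (\<forall>j. a \<le> j \<and> j < s \<longrightarrow> j \<in> occ)"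
proof -
  obtain k where k: "k < Suc n - a" "a + k \<notin> occ" "s = a + k"
      "\<forall>j<k. a + j \<in> occ"
    using assms by (auto simp: park_car_def find_Some_iff simp del: upt_Suc)
  have "j \<in> occ" if "a \<le> j" "j < s" for j
    using k(4)[rule_format, of "j - a"] that k(3) by auto
  then show ?thesis using k by auto
qed

lemma park_car_NoneD:
  assumes "park_car n occ a = None" "a \<le> j" "j \<le> n"
  shows "j \<in> occ"
  using assms by (auto simp: park_car_def find_None_iff simp del: upt_Suc)

text \<open>A car that fails on the street has found \<open>a, ..., n\<close> all taken, so on the
  circle it moves on to spot 0, which is still free.\<close>

lemma circ_park_eq_park_car:
  assumes "0 \<notin> occ" "a \<le> n"
  shows "circ_park (Suc n) occ a = (case park_car n occ a of None \<Rightarrow> 0 | Some s \<Rightarrow> s)"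
proof (cases "park_car n occ a")
  case None
  then have "circ_park (Suc n) occ a = (a + (Suc n - a)) mod Suc n"
    using assms park_car_NoneD[OF None] by (intro circ_park_first_free) auto
  then show ?thesis using None assms by simp
next
  case (Some s)
  have s: "a \<le> s" "s \<le> n" "s \<notin> occ" "\<And>j. a \<le> j \<Longrightarrow> j < s \<Longrightarrow> j \<in> occ"
    using park_car_SomeD[OF Some] by auto
  then have "circ_park (Suc n) occ a = (a + (s - a)) mod Suc n"
    by (intro circ_park_first_free) auto
  then show ?thesis using Some s by simp
qed

text \<open>Both processes occupy the same spots until some car fails. That car fills spot 0 on the
  circle, and the spot then stays filled.\<close>

lemma park_outcomes_all_park_iff:
  assumes "0 \<notin> occ" "set as \<subseteq> {1..n}"
  shows "None \<notin> set (park_outcomes n occ as) \<longleftrightarrow> 0 \<notin> circ_occ (Suc n) occ as"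
  using assms
proof (induction as arbitrary: occ)
  case (Cons a as)
  have cp: "circ_park (Suc n) occ a = (case park_car n occ a of None \<Rightarrow> 0 | Some s \<Rightarrow> s)"
    using Cons.prems by (intro circ_park_eq_park_car) auto
  show ?case
  proof (cases "park_car n occ a")
    case None
    then show ?thesis using cp circ_occ_mono[of "insert 0 occ" "Suc n" as] by auto
  next
    case (Some s)
    then have "0 < s" using park_car_SomeD[OF Some] Cons.prems by auto
    then show ?thesis using Some cp Cons.IH[of "insert s occ"] Cons.prems by simp
  qed
qed simp

text \<open>If no car fails, street and circle have the same occupied set whenever a car arrives, so
  both notions of luckiness agree.\<close>

lemma park_outcomes_lucky_iff:
  assumes "0 \<notin> occ" "set as \<subseteq> {1..n}" "None \<notin> set (park_outcomes n occ as)" "m < length as"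
  shows "park_outcomes n occ as ! m = Some (as ! m) \<longleftrightarrow> as ! m \<notin> circ_occ (Suc n) occ (take m as)"
  using assms
proof (induction as arbitrary: occ m)
  case (Cons a as)
  have cp: "circ_park (Suc n) occ a = (case park_car n occ a of None \<Rightarrow> 0 | Some s \<Rightarrow> s)"
    using Cons.prems by (intro circ_park_eq_park_car) auto
  obtain s where s: "park_car n occ a = Some s"
    using Cons.prems by (cases "park_car n occ a") auto
  note sD = park_car_SomeD[OF s]
  show ?case
  proof (cases m)
    case 0
    \<comment> \<open>If \<open>s\<close> differs from \<open>a\<close>, then \<open>a\<close> is
      one of the spots the car passed, hence occupied.\<close>
    have "s = a \<longleftrightarrow> a \<notin> occ" using sD by (metis le_neq_implies_less order_refl)
    then show ?thesis using 0 s by simp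
  next
    case (Suc m')
    have "0 < s" using sD Cons.prems by auto
    then show ?thesis using Suc s cp Cons.IH[of "insert s occ" m'] Cons.prems by simp
  qed
qed simp

lemma lucky_parking_function_iff:
  assumes "1 \<le> i" "i \<le> n"
  shows "parking_function n as \<and> lucky n as i \<longleftrightarrow>
    set as \<subseteq> {..<Suc n} \<and> length as = n \<and> circ_lucky (Suc n) (i - 1) as
    \<and> 0 \<notin> circ_occ (Suc n) {} as" (is "?l \<longleftrightarrow> ?r")
proof -
  have lucky: "lucky n as i \<longleftrightarrow> circ_lucky (Suc n) (i - 1) as" if "parking_function n as"
    unfolding lucky_def circ_lucky_def using that assms
    by (intro park_outcomes_lucky_iff) (auto simp: parking_function_def)
  have "parking_function n as \<longleftrightarrow>
    set as \<subseteq> {..<Suc n} \<and> length as = n \<and> 0 \<notin> circ_occ (Suc n) {} as" (is "_ \<longleftrightarrow> ?c")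
  proof
    assume "parking_function n as"
    then show ?c using park_outcomes_all_park_iff[of "{}" as n]
      by (auto simp: parking_function_def)
  next
    assume c: ?c
    \<comment> \<open>On the circle 0 is a legal preference, but any car preferring it would leave
      spot 0 occupied.\<close>
    then have "0 \<notin> set as" using set_subset_circ_occ by blast
    then have "x \<in> {1..n}" if "x \<in> set as" for x using that c by (cases x) auto
    then have "set as \<subseteq> {1..n}" by blast
    then show "parking_function n as" using c park_outcomes_all_park_iff[of "{}" as n]
      by (auto simp: parking_function_def)
  qed
  with lucky show ?thesis by blast
qed

section \<open>The number of lucky parking functions\<close>

lemma card_lucky_parking_functions:
  assumes "1 \<le> i" "i \<le> n"
  shows "Suc n * card {as. parking_function n as \<and> lucky n as i} = (n + 2 - i) * Suc n ^ (n - 1)"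
proof -
  have "{as. parking_function n as \<and> lucky n as i}
    = {as \<in> {as. set as \<subseteq> {..<Suc n} \<and> length as = n \<and> circ_lucky (Suc n) (i - 1) as}.
        0 \<notin> circ_occ (Suc n) {} as}"
    using lucky_parking_function_iff[OF assms] by blast
  moreover have "Suc n - (i - 1) = n + 2 - i" using assms by simp
  ultimately show ?thesis
    using card_circ_lucky_empty_spot[of "i - 1" n "Suc n"] card_circ_lucky[of "i - 1" n "Suc n"] assms
    by simp
qed

text \<open>The sets counted by \<open>q n i j\<close> split the lucky parking functions by the
  preference of car \<open>i\<close>, which lies in \<open>{1..n}\<close>.\<close>

lemma sum_q:
  assumes "1 \<le> i" "i \<le> n"
  shows "(\<Sum>j = 1..n. q n i j) = card {as. parking_function n as \<and> lucky n as i}"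
proof -
  let ?T = "{as. parking_function n as \<and> lucky n as i}"
  have "finite {as. set as \<subseteq> {1..n} \<and> length as = n}" by (rule finite_lists_length_eq) simp
  then have fin: "finite ?T" by (rule rev_finite_subset) (auto simp: parking_function_def)
  have "{j \<in> {1..n}. as ! (i - 1) = j} = {as ! (i - 1)}" if "as \<in> ?T" for as
  proof -
    have "as ! (i - 1) \<in> set as" "set as \<subseteq> {1..n}"
      using that assms by (auto simp: parking_function_def)
    then show ?thesis by blast
  qed
  then have "(\<Sum>j = 1..n. card {as \<in> ?T. as ! (i - 1) = j}) = 1 * card ?T"
    using fin by (intro sum_multicount) auto
  moreover have "{as \<in> ?T. as ! (i - 1) = j}
      = {as. parking_function n as \<and> as ! (i - 1) = j \<and> lucky n as i}" for j
    by blast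
  ultimately show ?thesis by (simp add: q_def)
qed

theorem corollary3p1:
  fixes n i :: nat
  assumes "n \<ge> 1" and "1 \<le> i" and "i \<le> n"
  shows "card {as. parking_function n as \<and> lucky n as i} = (\<Sum>j = 1..n. q n i j) \<and>
         (of_nat (\<Sum>j = 1..n. q n i j) :: rat) =
           (of_nat n + 2 - of_nat i) * (of_nat n + 1) powi (int n - 2) \<and>
         (of_nat n + 2 - of_nat i) * (of_nat n + 1) powi (int n - 2) =
           (1 - (of_nat i - 1) / (of_nat n + 1)) * (of_nat n + 1 :: rat) ^ (n - 1)"
proof -
  let ?C = "card {as. parking_function n as \<and> lucky n as i}"
  let ?x = "of_nat n + 1 :: rat"
  have x: "?x \<noteq> 0" by (metis of_nat_Suc of_nat_neq_0 add.commute)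
  \<comment> \<open>For \<open>n = 1\<close> the exponent is -1, so the power is written as a
    quotient with the natural exponent \<open>n - 1\<close>.\<close>
  have "int n - 2 = int (n - 1) - 1" using assms by simp
  then have powi: "?x powi (int n - 2) = ?x ^ (n - 1) / ?x"
    using x by (simp only: power_int_diff power_int_of_nat power_int_1_right simp_thms)
  have "(of_nat (Suc n * ?C) :: rat) = of_nat ((n + 2 - i) * Suc n ^ (n - 1))"
    using card_lucky_parking_functions[OF assms(2,3)] by (rule arg_cong)
  moreover have "(of_nat (Suc n) :: rat) = ?x" by simp
  moreover have "(of_nat (n + 2 - i) :: rat) = of_nat n + 2 - of_nat i"
    using assms by (simp add: of_nat_diff)
  ultimately have "?x * of_nat ?C = (of_nat n + 2 - of_nat i) * ?x ^ (n - 1)"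
    by (simp only: of_nat_mult of_nat_power)
  then have "of_nat ?C = (of_nat n + 2 - of_nat i) * ?x ^ (n - 1) / ?x"
    by (metis nonzero_mult_div_cancel_left x)
  then have "of_nat ?C = (of_nat n + 2 - of_nat i) * ?x powi (int n - 2)"
    by (simp only: powi times_divide_eq_right)
  moreover have "1 - (of_nat i - 1) / ?x = (of_nat n + 2 - of_nat i) / ?x"
    using x by (simp add: divide_simps)
  then have "(of_nat n + 2 - of_nat i) * ?x powi (int n - 2) =
      (1 - (of_nat i - 1) / ?x) * ?x ^ (n - 1)"
    by (simp only: powi times_divide_eq_right times_divide_eq_left)
  ultimately show ?thesis using sum_q[OF assms(2,3)] by simp
qed

end
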